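(* There exists a non-invertible substitution matrix $M$ such that the Bratteli diagram associated to $M$ is not telescope equivalent to the Bratteli diagram associated to any invertible substitution matrix (of any size).
   Context: A symbolic substitution on a finite nonempty alphabet $\mathcal L=\{l_1,\dots,l_n\}$ is a map $\sigma:\mathcal L\to\mathcal L^*$ into the finite words over $\mathcal L$. Its substitution matrix is the $n\times n$ non-negative integer matrix whose $(i,j)$-entry is the number of occurrences of $l_j$ in $\sigma(l_i)$. Invertible means nonzero determinant (invertible over $\mathbb Q$). A (labelled) Bratteli diagram $(V,E,r,s,d)$ is an infinite directed graph with $V=\bigsqcup_{n\ge 0}V_n$, $E=\bigsqcup_{n\ge1}E_n$, all $V_n,E_n$ finite and nonempty, with $s(e)\in V_{n-1}$ and $r(e)\in V_n$ for $e\in E_n$; $s^{-1}(v)\ne\varnothing$ for all $v$, $r^{-1}(v)\neq\varnothing$ for all $v\notin V_0$; and a labelling $d:V\to\mathbb N$ with $d(v)=\sum_{r(e)=v}d(s(e))$ for $v\notin V_0$. The transition matrix from level $n-1$ to level $n$ has $(i,j)$-entry equal to the number of edges from the $i$-th vertex of $V_{n-1}$ to the $j$-th vertex of $V_n$. Two diagrams are isomorphic if there are bijections between their vertices and edges (level by level) preserving labels, range and source. Given a strictly increasing sequence $(m_n)_{n\ge0}$ of non-negative integers, the telescoping of the diagram has $V_n'=V_{m_n}$, $E_n'$ the set of paths from $V_{m_{n-1}}$ to $V_{m_n}$, with the induced range and source and restricted labelling; microscoping is the inverse operation. Two diagrams are telescope equivalent if one is obtained from the other by finitely many telescopings, microscopings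 and isomorphisms. The Bratteli diagram defined by (associated to) an $n\times n$ substitution matrix $M$ has $n$ vertices at every level, all labels equal to $1$ at level $0$, and every transition matrix equal to $M$ (it is understood that $M$ has no zero row or column, so that this is a Bratteli diagram). *)

theory Defs
  imports "Jordan_Normal_Form.Determinant" "HOL-Library.Disjoint_Sets"
begin

section \<open>Substitutions and their matrices\<close>

text \<open>The alphabet is given by a list \<open>ls\<close> enumerating its letters without repetition.\<close>

definition substitution :: "'a list \<Rightarrow> ('a \<Rightarrow> 'a list) \<Rightarrow> bool" where
  "substitution ls \<sigma> \<longleftrightarrow> ls \<noteq> [] \<and> distinct ls \<and> (\<forall>a\<in>set ls. set (\<sigma> a) \<subseteq> set ls)"

definition matrix_of_substitution :: "'a list \<Rightarrow> ('a \<Rightarrow> 'a list) \<Rightarrow> nat mat" where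
  "matrix_of_substitution ls \<sigma> =
     mat (length ls) (length ls) (\<lambda>(i, j). count_list (\<sigma> (ls ! i)) (ls ! j))"

text \<open>Taking letters in \<open>nat\<close> loses nothing: every finite alphabet can be renamed.\<close>

definition substitution_matrix :: "nat mat \<Rightarrow> bool" where
  "substitution_matrix M \<longleftrightarrow>
     (\<exists>(ls :: nat list) \<sigma>. substitution ls \<sigma> \<and> M = matrix_of_substitution ls \<sigma>)"

definition invertible_over_rat :: "nat mat \<Rightarrow> bool" where
  "invertible_over_rat M \<longleftrightarrow> det (map_mat rat_of_nat M) \<noteq> 0"

definition no_zero_row_or_column :: "nat mat \<Rightarrow> bool" where
  "no_zero_row_or_column M \<longleftrightarrow>
     (\<forall>i<dim_row M. \<exists>j<dim_col M. M $$ (i, j) \<noteq> 0) \<and>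
     (\<forall>j<dim_col M. \<exists>i<dim_row M. M $$ (i, j) \<noteq> 0)"


section \<open>Labelled Bratteli diagrams\<close>

text \<open>\<open>edges n\<close> is the set of edges from level \<open>n - 1\<close> to level \<open>n\<close>, so \<open>edges 0\<close> is empty.
  The values of \<open>src\<close>, \<open>rng\<close>, \<open>lab\<close> outside the edges and vertices are irrelevant.\<close>

record ('v, 'e) diagram =
  verts :: "nat \<Rightarrow> 'v set"
  edges :: "nat \<Rightarrow> 'e set"
  src :: "'e \<Rightarrow> 'v"
  rng :: "'e \<Rightarrow> 'v"
  lab :: "'v \<Rightarrow> nat"

definition bratteli :: "('v, 'e) diagram \<Rightarrow> bool" where
  "bratteli B \<longleftrightarrow>
     disjoint_family (verts B) \<and> disjoint_family (edges B) \<and>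
     (\<forall>n. finite (verts B n) \<and> verts B n \<noteq> {}) \<and>
     edges B 0 = {} \<and> (\<forall>n\<ge>1. finite (edges B n) \<and> edges B n \<noteq> {}) \<and>
     (\<forall>n\<ge>1. \<forall>e\<in>edges B n. src B e \<in> verts B (n - 1) \<and> rng B e \<in> verts B n) \<and>
     (\<forall>n. \<forall>v\<in>verts B n. {e \<in> edges B (n + 1). src B e = v} \<noteq> {}) \<and>
     (\<forall>n\<ge>1. \<forall>v\<in>verts B n. {e \<in> edges B n. rng B e = v} \<noteq> {}) \<and>
     (\<forall>n\<ge>1. \<forall>v\<in>verts B n. lab B v = (\<Sum>e\<in>{e \<in> edges B n. rng B e = v}. lab B (src B e)))"

definition isomorphic :: "('v, 'e) diagram \<Rightarrow> ('w, 'f) diagram \<Rightarrow> bool" where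
  "isomorphic B C \<longleftrightarrow> (\<exists>f g.
     (\<forall>n. bij_betw f (verts B n) (verts C n)) \<and>
     (\<forall>n. bij_betw g (edges B n) (edges C n)) \<and>
     (\<forall>n. \<forall>v\<in>verts B n. lab C (f v) = lab B v) \<and>
     (\<forall>n. \<forall>e\<in>edges B n. src C (g e) = f (src B e) \<and> rng C (g e) = f (rng B e)))"


section \<open>Telescope equivalence\<close>

definition paths :: "('v, 'e) diagram \<Rightarrow> nat \<Rightarrow> nat \<Rightarrow> 'e list set" where
  "paths B a b = {p. length p = b - a \<and>
     (\<forall>i<length p. p ! i \<in> edges B (a + i + 1)) \<and>
     (\<forall>i. i + 1 < length p \<longrightarrow> rng B (p ! i) = src B (p ! (i + 1)))}"

definition telescoping :: "('v, 'e) diagram \<Rightarrow> (nat \<Rightarrow> nat) \<Rightarrow> ('v, 'e list) diagram" where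
  "telescoping B m = \<lparr>
     verts = (\<lambda>n. verts B (m n)),
     edges = (\<lambda>n. if n = 0 then {} else paths B (m (n - 1)) (m n)),
     src = (\<lambda>p. src B (hd p)),
     rng = (\<lambda>p. rng B (last p)),
     lab = lab B\<rparr>"

text \<open>Telescoping changes the type of edges, so the chains of telescopings, microscopings and
  isomorphisms are built inside the fixed type \<open>(nat, nat) diagram\<close>, where a telescoping is taken
  up to isomorphism. As all levels are finite, every Bratteli diagram is isomorphic to one of
  this type, so no diagram is lost.\<close>

definition telescope_step :: "(nat, nat) diagram \<Rightarrow> (nat, nat) diagram \<Rightarrow> bool" where
  "telescope_step B C \<longleftrightarrow> bratteli B \<and> bratteli C \<and>
     (isomorphic B C \<or> (\<exists>m. strict_mono m \<and> isomorphic (telescoping B m) C))"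

text \<open>\<open>equivclp\<close> also uses each step backwards, which gives the microscopings.\<close>

definition telescope_equivalent :: "('v, 'e) diagram \<Rightarrow> ('w, 'f) diagram \<Rightarrow> bool" where
  "telescope_equivalent D D' \<longleftrightarrow> bratteli D \<and> bratteli D' \<and>
     (\<exists>B C. bratteli B \<and> bratteli C \<and>
        isomorphic D B \<and> equivclp telescope_step B C \<and> isomorphic C D')"


section \<open>The diagram of a square matrix\<close>

primrec matrix_label :: "nat mat \<Rightarrow> nat \<Rightarrow> nat \<Rightarrow> nat" where
  "matrix_label M 0 j = 1"
| "matrix_label M (Suc n) j = (\<Sum>i<dim_row M. matrix_label M n i * M $$ (i, j))"

text \<open>Vertex \<open>(n, i)\<close> is the \<open>i\<close>-th vertex of level \<open>n\<close>; edge \<open>(n, i, j, c)\<close> is the \<open>c\<close>-th edge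
  from \<open>(n - 1, i)\<close> to \<open>(n, j)\<close>.\<close>

definition matrix_diagram :: "nat mat \<Rightarrow> (nat \<times> nat, nat \<times> nat \<times> nat \<times> nat) diagram" where
  "matrix_diagram M = \<lparr>
     verts = (\<lambda>n. {n} \<times> {..<dim_row M}),
     edges = (\<lambda>n. {(n, i, j, c) | i j c.
                    n \<ge> 1 \<and> i < dim_row M \<and> j < dim_row M \<and> c < M $$ (i, j)}),
     src = (\<lambda>(n, i, j, c). (n - 1, i)),
     rng = (\<lambda>(n, i, j, c). (n, j)),
     lab = (\<lambda>(n, j). matrix_label M n j)\<rparr>"

lemma matrix_diagram_bratteli:
  assumes sq: "dim_row M = dim_col M" and pos: "dim_row M > 0"
    and nz: "no_zero_row_or_column M"
  shows "bratteli (matrix_diagram M)"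
proof -
  let ?B = "matrix_diagram M" and ?k = "dim_row M"
  have E: "edges ?B n = (if n = 0 then {} else
      (\<lambda>(i, j, c). (n, i, j, c)) ` (SIGMA i:{..<?k}. SIGMA j:{..<?k}. {..<M $$ (i, j)}))" for n
    by (auto simp: matrix_diagram_def)
  have row: "\<exists>j<?k. M $$ (i, j) > 0" if "i < ?k" for i
    using nz that sq by (auto simp: no_zero_row_or_column_def)
  have col: "\<exists>i<?k. M $$ (i, j) > 0" if "j < ?k" for j
    using nz that sq by (auto simp: no_zero_row_or_column_def)
  have into: "{e \<in> edges ?B n. rng ?B e = (n, j)} =
      (\<lambda>(i, c). (n, i, j, c)) ` (SIGMA i:{..<?k}. {..<M $$ (i, j)})" if "n \<ge> 1" "j < ?k" for n j
    using that by (auto simp: matrix_diagram_def)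
  have lab: "lab ?B (n, j) = (\<Sum>e\<in>{e \<in> edges ?B n. rng ?B e = (n, j)}. lab ?B (src ?B e))"
    if nj: "n \<ge> 1" "j < ?k" for n j
  proof -
    have inj: "inj_on (\<lambda>(i, c). (n, i, j, c)) (SIGMA i:{..<?k}. {..<M $$ (i, j)})"
      by (auto simp: inj_on_def)
    have "(\<Sum>e\<in>{e \<in> edges ?B n. rng ?B e = (n, j)}. lab ?B (src ?B e)) =
        (\<Sum>(i, c)\<in>(SIGMA i:{..<?k}. {..<M $$ (i, j)}). matrix_label M (n - 1) i)"
      unfolding into[OF nj] sum.reindex[OF inj]
      by (rule sum.cong) (auto simp: matrix_diagram_def)
    also have "\<dots> = (\<Sum>i<?k. \<Sum>c<M $$ (i, j). matrix_label M (n - 1) i)"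
      by (subst sum.Sigma) auto
    also have "\<dots> = matrix_label M n j"
      using nj by (cases n) (auto simp: mult.commute)
    finally show ?thesis
      by (simp add: matrix_diagram_def)
  qed
  have V: "verts ?B n = {n} \<times> {..<?k}" for n
    by (simp add: matrix_diagram_def)
  have ends: "src ?B e \<in> verts ?B (n - 1) \<and> rng ?B e \<in> verts ?B n" if "e \<in> edges ?B n" for n e
    using that by (auto simp: matrix_diagram_def)
  have out_ne: "{e \<in> edges ?B (n + 1). src ?B e = v} \<noteq> {}" if vn: "v \<in> verts ?B n" for n v
  proof -
    obtain i where v: "v = (n, i)" "i < ?k"
      using vn by (auto simp: V)
    obtain j where "j < ?k" "M $$ (i, j) > 0"
      using row[OF v(2)] by blast
    then have "(n + 1, i, j, 0) \<in> {e \<in> edges ?B (n + 1). src ?B e = v}"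
      using v by (auto simp: matrix_diagram_def)
    then show ?thesis by blast
  qed
  have in_ne: "{e \<in> edges ?B n. rng ?B e = v} \<noteq> {}" if vn: "n \<ge> 1" "v \<in> verts ?B n" for n v
  proof -
    obtain j where v: "v = (n, j)" "j < ?k"
      using vn by (auto simp: V)
    obtain i where "i < ?k" "M $$ (i, j) > 0"
      using col[OF v(2)] by blast
    then have "(n, i, j, 0) \<in> {e \<in> edges ?B n. rng ?B e = v}"
      using v that by (auto simp: matrix_diagram_def)
    then show ?thesis by blast
  qed
  have Vne: "verts ?B n \<noteq> {}" for n
    using pos by (auto simp: V)
  have Ene: "edges ?B n \<noteq> {}" if "n \<ge> 1" for n
    using Vne[of n] in_ne[OF that] by blast
  have dis: "disjoint_family (verts ?B)" "disjoint_family (edges ?B)"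
    by (auto simp: disjoint_family_on_def matrix_diagram_def)
  have fin: "finite (verts ?B n)" "finite (edges ?B n)" for n
    by (auto simp: V E)
  have E0: "edges ?B 0 = {}"
    by (simp add: E)
  have lab': "\<forall>n\<ge>1. \<forall>v\<in>verts ?B n.
      lab ?B v = (\<Sum>e\<in>{e \<in> edges ?B n. rng ?B e = v}. lab ?B (src ?B e))"
    using lab by (auto simp: V)
  show ?thesis
    unfolding bratteli_def using dis fin Vne E0 Ene ends out_ne in_ne lab' by blast
qed

end

theory Submission
  imports Defs
begin

text \<open>
  Row vectors over the vertices of the successive levels, pushed upwards by the transition
  matrices, form a direct system of free abelian groups. Its limit \<open>G\<close>, with the class \<open>u\<close> of the
  label vector, is the group part of the dimension group of the diagram; telescoping only passes
  to a cofinal subsystem, so whatever can be said about \<open>(G, u)\<close> is unchanged under telescope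
  equivalence. The proof compares two such properties, phrased on the diagrams themselves so that
  \<open>G\<close> never has to be built.

  \<^item> \<open>rank_one_limit\<close>: every element of \<open>G\<close> is rationally proportional to \<open>u\<close>. For an invertible
    \<open>k \<times> k\<close> matrix the system is injective over the rationals, \<open>G\<close> has rank \<open>k\<close>, and the
    property forces \<open>k = 1\<close> (\<open>invertible_not_rank_one_limit\<close>).
  \<^item> \<open>divides_level d\<close>: \<open>u\<close> is divisible by \<open>d\<close> in \<open>G\<close>. For a \<open>1 \<times> 1\<close> matrix \<open>(k)\<close> the labels
    are the powers of \<open>k\<close>, so divisibility by 2 entails divisibility by 4
    (\<open>divides_level_one_by_one\<close>).

  The matrix with both rows equal to \<open>(1, 2)\<close> has rank one, and its labels above level 0 are
  \<open>2 \<cdot> 3\<^sup>n \<cdot> (1, 2)\<close>. Here \<open>G\<close> is \<open>\<int>[1/3]\<close> with \<open>u = 2\<close>: of rank one, with a \<open>u\<close> divisible by 2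
  but not by 4. The prime 2 enters once, through the column sums at the first step, and
  never again, since the nonzero eigenvalue is 3.
\<close>

section \<open>Additive functions on the levels of a diagram\<close>

text \<open>
  An additive \<open>f\<close> is a row vector at level \<open>a\<close> together with its images at all later levels, that is, a
  representative of an element of the limit group. The level is a separate argument, so
  that restriction to a telescoping along \<open>m\<close> is just \<open>\<lambda>n. f (m n)\<close>.
\<close>

definition additive_from :: "('v, 'e) diagram \<Rightarrow> nat \<Rightarrow> (nat \<Rightarrow> 'v \<Rightarrow> int) \<Rightarrow> bool" where
  "additive_from B a f \<longleftrightarrow>
     (\<forall>n\<ge>a. \<forall>v\<in>verts B (Suc n).
        f (Suc n) v = (\<Sum>e\<in>{e \<in> edges B (Suc n). rng B e = v}. f n (src B e)))"

definition label_proportional :: "('v, 'e) diagram \<Rightarrow> (nat \<Rightarrow> 'v \<Rightarrow> int) \<Rightarrow> nat \<Rightarrow> bool" where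
  "label_proportional B f n \<longleftrightarrow>
     (\<forall>v\<in>verts B n. \<forall>w\<in>verts B n. f n v * int (lab B w) = f n w * int (lab B v))"

text \<open>
  Allowing every starting level \<open>a\<close> is what makes the property survive telescoping in both
  directions: an additive function need not extend to levels below the one where it starts.
\<close>

definition rank_one_limit :: "('v, 'e) diagram \<Rightarrow> bool" where
  "rank_one_limit B \<longleftrightarrow>
     (\<forall>a f. additive_from B a f \<longrightarrow> (\<exists>n\<ge>a. label_proportional B f n))"

definition divides_level :: "nat \<Rightarrow> ('v, 'e) diagram \<Rightarrow> bool" where
  "divides_level d B \<longleftrightarrow> (\<exists>n. \<forall>v\<in>verts B n. d dvd lab B v)"

text \<open>
  The incidence conditions alone pass to a telescoping directly from those of the diagram, and
  they suffice to transport additive functions along an isomorphism.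
\<close>

definition graded :: "('v, 'e) diagram \<Rightarrow> bool" where
  "graded B \<longleftrightarrow>
     (\<forall>n. \<forall>e\<in>edges B (Suc n). src B e \<in> verts B n \<and> rng B e \<in> verts B (Suc n))"

lemma gradedD:
  assumes "graded B" "e \<in> edges B (Suc n)"
  shows "src B e \<in> verts B n" "rng B e \<in> verts B (Suc n)"
  using assms by (auto simp: graded_def)

lemma bratteli_graded:
  assumes "bratteli B"
  shows "graded B"
proof -
  have "\<forall>n\<ge>1. \<forall>e\<in>edges B n. src B e \<in> verts B (n - 1) \<and> rng B e \<in> verts B n"
    using assms unfolding bratteli_def by blast
  from this[rule_format, of "Suc n" for n] show ?thesis
    unfolding graded_def by auto
qed

lemma bratteli_finite_edges:
  assumes "bratteli B"
  shows "finite (edges B n)"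
proof (cases n)
  case 0
  then show ?thesis using assms by (simp add: bratteli_def)
next
  case (Suc k)
  then have "n \<ge> 1" by simp
  then show ?thesis using assms unfolding bratteli_def by blast
qed

lemma bratteli_lab_Suc:
  assumes "bratteli B" "v \<in> verts B (Suc n)"
  shows "lab B v = (\<Sum>e\<in>{e \<in> edges B (Suc n). rng B e = v}. lab B (src B e))"
proof -
  have "\<forall>n\<ge>1. \<forall>v\<in>verts B n.
      lab B v = (\<Sum>e\<in>{e \<in> edges B n. rng B e = v}. lab B (src B e))"
    using assms(1) unfolding bratteli_def by blast
  from this[rule_format, of "Suc n" v] show ?thesis
    using assms(2) by simp
qed

lemma additive_fromD:
  assumes "additive_from B a f" "a \<le> n" "v \<in> verts B (Suc n)"
  shows "f (Suc n) v = (\<Sum>e\<in>{e \<in> edges B (Suc n). rng B e = v}. f n (src B e))"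
  using assms by (auto simp: additive_from_def)

lemma rank_one_limitE:
  assumes "rank_one_limit B" "additive_from B a f"
  obtains n where "a \<le> n" "label_proportional B f n"
  using assms unfolding rank_one_limit_def by blast

lemma additive_from_mono:
  assumes "additive_from B a f" "a \<le> b"
  shows "additive_from B b f"
  using assms by (auto simp: additive_from_def)

lemma additive_from_cong:
  assumes gr: "graded B" and eq: "\<And>n v. a \<le> n \<Longrightarrow> v \<in> verts B n \<Longrightarrow> f n v = g n v"
  shows "additive_from B a f \<longleftrightarrow> additive_from B a g"
proof -
  have "(\<Sum>e\<in>{e \<in> edges B (Suc n). rng B e = v}. f n (src B e)) =
      (\<Sum>e\<in>{e \<in> edges B (Suc n). rng B e = v}. g n (src B e))" if "a \<le> n" for n v
    using eq[OF that] gradedD(1)[OF gr] by (auto intro!: sum.cong)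
  then show ?thesis
    using eq by (auto simp: additive_from_def)
qed

lemma additive_from_unique:
  assumes gr: "graded B" and f: "additive_from B a f" and g: "additive_from B a g"
    and start: "\<And>v. v \<in> verts B a \<Longrightarrow> f a v = g a v"
    and "a \<le> n" "v \<in> verts B n"
  shows "f n v = g n v"
  using \<open>a \<le> n\<close> \<open>v \<in> verts B n\<close>
proof (induction n arbitrary: v rule: dec_induct)
  case base
  then show ?case by (rule start)
next
  case (step n)
  show ?case
    unfolding additive_fromD[OF f step.hyps(1) step.prems] additive_fromD[OF g step.hyps(1) step.prems]
    using step.IH gradedD(1)[OF gr] by (auto intro!: sum.cong)
qed

text \<open>
  Additive functions and labels obey the same linear recursion, so the vanishing of all
  \<open>2 \<times> 2\<close> minors at one level expands bilinearly to the next. Being stated with minors rather than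
  with a factor of proportionality, this also covers labels that are zero.
\<close>

lemma label_proportional_Suc:
  assumes B: "bratteli B" and f: "additive_from B a f" and "a \<le> n"
    and proportional: "label_proportional B f n"
  shows "label_proportional B f (Suc n)"
  unfolding label_proportional_def
proof (intro ballI)
  fix v w assume v: "v \<in> verts B (Suc n)" and w: "w \<in> verts B (Suc n)"
  let ?I = "\<lambda>x. {e \<in> edges B (Suc n). rng B e = x}"
  have cross: "f n (src B e) * int (lab B (src B e')) = f n (src B e') * int (lab B (src B e))"
    if "e \<in> ?I v" "e' \<in> ?I w" for e e'
    using proportional that gradedD(1)[OF bratteli_graded[OF B]] by (auto simp: label_proportional_def)
  have "f (Suc n) v * int (lab B w) =
      (\<Sum>e\<in>?I v. \<Sum>e'\<in>?I w. f n (src B e) * int (lab B (src B e')))"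
    unfolding additive_fromD[OF f \<open>a \<le> n\<close> v] bratteli_lab_Suc[OF B w] of_nat_sum by (rule sum_product)
  also have "\<dots> = (\<Sum>e\<in>?I v. \<Sum>e'\<in>?I w. f n (src B e') * int (lab B (src B e)))"
    using cross by (intro sum.cong refl)
  also have "\<dots> = (\<Sum>e'\<in>?I w. \<Sum>e\<in>?I v. f n (src B e') * int (lab B (src B e)))"
    by (rule sum.swap)
  also have "\<dots> = f (Suc n) w * int (lab B v)"
    unfolding additive_fromD[OF f \<open>a \<le> n\<close> w] bratteli_lab_Suc[OF B v] of_nat_sum
    by (rule sum_product[symmetric])
  finally show "f (Suc n) v * int (lab B w) = f (Suc n) w * int (lab B v)" .
qed

lemma label_proportional_mono:
  assumes "bratteli B" "additive_from B a f" "a \<le> n" "n \<le> n'" "label_proportional B f n"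
  shows "label_proportional B f n'"
  using \<open>n \<le> n'\<close>
proof (induction n' rule: dec_induct)
  case base
  show ?case by fact
next
  case (step k)
  then show ?case
    using label_proportional_Suc[OF assms(1,2)] \<open>a \<le> n\<close> by simp
qed

lemma dvd_lab_mono:
  assumes B: "bratteli B" and d: "\<And>v. v \<in> verts B n \<Longrightarrow> d dvd lab B v"
    and "n \<le> n'" "v \<in> verts B n'"
  shows "d dvd lab B v"
  using \<open>n \<le> n'\<close> \<open>v \<in> verts B n'\<close>
proof (induction n' arbitrary: v rule: dec_induct)
  case base
  then show ?case by (rule d)
next
  case (step k)
  show ?case
    unfolding bratteli_lab_Suc[OF B step.prems]
    using step.IH gradedD(1)[OF bratteli_graded[OF B]] by (auto intro!: dvd_sum)
qed


section \<open>Invariance under isomorphism\<close>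

lemma additive_from_iso:
  assumes gr: "graded B"
    and \<phi>: "\<And>n. bij_betw \<phi> (verts B n) (verts C n)"
    and \<gamma>: "\<And>n. bij_betw \<gamma> (edges B n) (edges C n)"
    and ends: "\<And>n e. e \<in> edges B n \<Longrightarrow> src C (\<gamma> e) = \<phi> (src B e) \<and> rng C (\<gamma> e) = \<phi> (rng B e)"
  shows "additive_from B a (\<lambda>n v. f n (\<phi> v)) \<longleftrightarrow> additive_from C a f"
proof -
  have sums: "(\<Sum>e\<in>{e \<in> edges C (Suc n). rng C e = \<phi> v}. f n (src C e)) =
      (\<Sum>e\<in>{e \<in> edges B (Suc n). rng B e = v}. f n (\<phi> (src B e)))"
    if v: "v \<in> verts B (Suc n)" for n v
  proof -
    have "rng C (\<gamma> e) = \<phi> v \<longleftrightarrow> rng B e = v" if "e \<in> edges B (Suc n)" for e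
      using ends[OF that] gradedD(2)[OF gr that] v \<phi>[of "Suc n"]
      by (metis bij_betw_imp_inj_on inj_on_eq_iff)
    then have im: "{e \<in> edges C (Suc n). rng C e = \<phi> v} =
        \<gamma> ` {e \<in> edges B (Suc n). rng B e = v}"
      unfolding bij_betw_imp_surj_on[OF \<gamma>[of "Suc n"], symmetric] by auto
    have inj: "inj_on \<gamma> {e \<in> edges B (Suc n). rng B e = v}"
      using bij_betw_imp_inj_on[OF \<gamma>[of "Suc n"]] by (rule inj_on_subset) auto
    show ?thesis
      unfolding im sum.reindex[OF inj] using ends by (auto intro!: sum.cong)
  qed
  have im: "verts C n = \<phi> ` verts B n" for n
    using \<phi>[of n] by (simp add: bij_betw_def)
  show ?thesis
    unfolding additive_from_def im ball_simps by (simp add: sums cong: ball_cong)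
qed

lemma rank_one_limit_iso:
  assumes gr: "graded B" and iso: "isomorphic B C"
  shows "rank_one_limit B \<longleftrightarrow> rank_one_limit C"
proof -
  obtain \<phi> \<gamma> where \<phi>: "\<And>n. bij_betw \<phi> (verts B n) (verts C n)"
    and \<gamma>: "\<And>n. bij_betw \<gamma> (edges B n) (edges C n)"
    and lab: "\<And>n v. v \<in> verts B n \<Longrightarrow> lab C (\<phi> v) = lab B v"
    and ends: "\<And>n e. e \<in> edges B n \<Longrightarrow> src C (\<gamma> e) = \<phi> (src B e) \<and> rng C (\<gamma> e) = \<phi> (rng B e)"
    using iso unfolding isomorphic_def by blast
  have im: "verts C n = \<phi> ` verts B n" for n
    using \<phi>[of n] by (simp add: bij_betw_def)
  have proportional: "label_proportional B (\<lambda>n v. f n (\<phi> v)) n \<longleftrightarrow> label_proportional C f n" for f n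
    by (simp add: label_proportional_def im lab)
  have add: "additive_from B a (\<lambda>n v. f n (\<phi> v)) \<longleftrightarrow> additive_from C a f" for a f
    by (rule additive_from_iso[OF gr \<phi> \<gamma> ends])
  show ?thesis
  proof
    assume B: "rank_one_limit B"
    show "rank_one_limit C"
      unfolding rank_one_limit_def
    proof (intro allI impI)
      fix a f assume "additive_from C a f"
      then have "additive_from B a (\<lambda>n v. f n (\<phi> v))"
        by (subst add)
      then obtain n where n: "a \<le> n" "label_proportional B (\<lambda>n v. f n (\<phi> v)) n"
        by (rule rank_one_limitE[OF B])
      have "label_proportional C f n"
        using n(2) by (subst (asm) proportional)
      with n(1) show "\<exists>n\<ge>a. label_proportional C f n" by blast
    qed
  next
    assume C: "rank_one_limit C"
    show "rank_one_limit B"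
      unfolding rank_one_limit_def
    proof (intro allI impI)
      fix a f assume f: "additive_from B a f"
      \<comment> \<open>The vertex bijection is inverted separately on each level.\<close>
      define g where "g n w = f n (inv_into (verts B n) \<phi> w)" for n w
      have g: "g n (\<phi> v) = f n v" if "v \<in> verts B n" for n v
        using that bij_betw_imp_inj_on[OF \<phi>[of n]] by (simp add: g_def)
      have "additive_from B a (\<lambda>n v. g n (\<phi> v)) \<longleftrightarrow> additive_from B a f"
        by (rule additive_from_cong[OF gr g])
      with f have "additive_from C a g"
        by (simp only: add)
      then obtain n where n: "a \<le> n" "label_proportional C g n"
        by (rule rank_one_limitE[OF C])
      have "label_proportional B (\<lambda>n v. g n (\<phi> v)) n"
        using n(2) by (subst proportional)
      then have "label_proportional B f n"
        by (simp add: label_proportional_def g)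
      with n(1) show "\<exists>n\<ge>a. label_proportional B f n" by blast
    qed
  qed
qed

lemma divides_level_iso:
  assumes "isomorphic B C"
  shows "divides_level d B \<longleftrightarrow> divides_level d C"
proof -
  obtain \<phi> where \<phi>: "\<And>n. bij_betw \<phi> (verts B n) (verts C n)"
    and lab: "\<And>n v. v \<in> verts B n \<Longrightarrow> lab C (\<phi> v) = lab B v"
    using assms unfolding isomorphic_def by blast
  have "verts C n = \<phi> ` verts B n" for n
    using \<phi>[of n] by (simp add: bij_betw_def)
  then show ?thesis
    using lab by (simp add: divides_level_def)
qed


section \<open>Invariance under telescoping\<close>

lemma finite_paths:
  assumes "bratteli B"
  shows "finite (paths B a b)"
proof (rule finite_subset)
  show "paths B a b \<subseteq> {p. set p \<subseteq> (\<Union>n\<le>b. edges B n) \<and> length p = b - a}"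
  proof
    fix p assume p: "p \<in> paths B a b"
    have "e \<in> (\<Union>n\<le>b. edges B n)" if e: "e \<in> set p" for e
    proof -
      obtain i where "i < length p" "e = p ! i"
        using e by (auto simp: in_set_conv_nth)
      then have "e \<in> edges B (a + i + 1)" "a + i + 1 \<le> b"
        using p by (auto simp: paths_def)
      then show ?thesis by blast
    qed
    then show "p \<in> {p. set p \<subseteq> (\<Union>n\<le>b. edges B n) \<and> length p = b - a}"
      using p by (auto simp: paths_def)
  qed
  show "finite {p. set p \<subseteq> (\<Union>n\<le>b. edges B n) \<and> length p = b - a}"
    using bratteli_finite_edges[OF assms] by (intro finite_lists_length_eq) auto
qed

lemma paths_one: "paths B a (Suc a) = (\<lambda>e. [e]) ` edges B (Suc a)"
  by (auto simp: paths_def length_Suc_conv)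

lemma paths_snoc:
  assumes "a < b"
  shows "q @ [e] \<in> paths B a (Suc b) \<longleftrightarrow>
    q \<in> paths B a b \<and> e \<in> edges B (Suc b) \<and> rng B (last q) = src B e"
proof (cases "length q = b - a")
  case False
  then show ?thesis using assms by (auto simp: paths_def)
next
  case True
  then have len: "length q = b - a" "length q > 0" "a + length q = b" "q \<noteq> []"
    using assms by auto
  have "(\<forall>i<length (q @ [e]). (q @ [e]) ! i \<in> edges B (a + i + 1)) \<longleftrightarrow>
      (\<forall>i<length q. q ! i \<in> edges B (a + i + 1)) \<and> e \<in> edges B (Suc b)"
    using len by (auto simp: nth_append less_Suc_eq)
  moreover have "(\<forall>i. i + 1 < length (q @ [e]) \<longrightarrow>
        rng B ((q @ [e]) ! i) = src B ((q @ [e]) ! (i + 1))) \<longleftrightarrow>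
      (\<forall>i. i + 1 < length q \<longrightarrow> rng B (q ! i) = src B (q ! (i + 1))) \<and>
      rng B (last q) = src B e" (is "?L \<longleftrightarrow> ?R")
  proof
    assume L: ?L
    have "rng B (q ! i) = src B (q ! (i + 1))" if "i + 1 < length q" for i
      using L[rule_format, of i] that by (simp add: nth_append)
    moreover have "rng B (last q) = src B e"
    proof -
      obtain k where "length q = Suc k" using len(2) by (cases "length q") auto
      then show ?thesis
        using L[rule_format, of k] len(4) by (simp add: nth_append last_conv_nth)
    qed
    ultimately show ?R by blast
  next
    assume R: ?R
    show ?L
    proof (intro allI impI)
      fix i assume i: "i + 1 < length (q @ [e])"
      show "rng B ((q @ [e]) ! i) = src B ((q @ [e]) ! (i + 1))"
      proof (cases "i + 1 < length q")
        case True
        then show ?thesis using R by (simp add: nth_append)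
      next
        case False
        then have "length q = Suc i" using i by simp
        then show ?thesis using R len(4) by (simp add: nth_append last_conv_nth)
      qed
    qed
  qed
  ultimately show ?thesis
    using len assms by (simp add: paths_def Suc_diff_le) blast
qed

lemma graded_telescoping:
  assumes gr: "graded B" and m: "strict_mono m"
  shows "graded (telescoping B m)"
  unfolding graded_def
proof (intro allI ballI)
  fix n p assume "p \<in> edges (telescoping B m) (Suc n)"
  then have p: "p \<in> paths B (m n) (m (Suc n))"
    by (simp add: telescoping_def)
  have less: "m n < m (Suc n)"
    using m by (simp add: strict_mono_def)
  have len: "length p = m (Suc n) - m n" "p \<noteq> []"
    using p less by (auto simp: paths_def)
  have e: "p ! i \<in> edges B (Suc (m n + i))" if "i < length p" for i
    using p that by (auto simp: paths_def)
  have "src B (hd p) \<in> verts B (m n)"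
    using gradedD(1)[OF gr e[of 0]] len(2) by (simp add: hd_conv_nth)
  moreover have "Suc (m n + (length p - 1)) = m (Suc n)"
    using len(1) less by simp
  then have "rng B (last p) \<in> verts B (m (Suc n))"
    using gradedD(2)[OF gr e[of "length p - 1"]] len(2) by (simp add: last_conv_nth)
  ultimately show "src (telescoping B m) p \<in> verts (telescoping B m) n \<and>
      rng (telescoping B m) p \<in> verts (telescoping B m) (Suc n)"
    by (simp add: telescoping_def)
qed

text \<open>
  Iterating the recursion over \<open>c - b\<close> levels counts every path once; it is split at its
  last edge. This is what relates the edges of a telescoping to those of the diagram.
\<close>

lemma additive_from_paths:
  assumes B: "bratteli B" and f: "additive_from B a f" and "a \<le> b" "b < c" "w \<in> verts B c"
  shows "f c w = (\<Sum>p\<in>{p \<in> paths B b c. rng B (last p) = w}. f b (src B (hd p)))"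
proof -
  have "Suc b \<le> c" using \<open>b < c\<close> by simp
  then show ?thesis using \<open>w \<in> verts B c\<close>
  proof (induction c arbitrary: w rule: dec_induct)
    case base
    have im: "{p \<in> paths B b (Suc b). rng B (last p) = w} =
        (\<lambda>e. [e]) ` {e \<in> edges B (Suc b). rng B e = w}"
      by (auto simp: paths_one)
    show ?case
      unfolding additive_fromD[OF f \<open>a \<le> b\<close> base] im
      by (subst sum.reindex) (auto simp: inj_on_def)
  next
    case (step c)
    have bc: "b < c" and ac: "a \<le> c" using step.hyps \<open>a \<le> b\<close> by auto
    let ?I = "{e \<in> edges B (Suc c). rng B e = w}"
    let ?P = "\<lambda>v. {p \<in> paths B b c. rng B (last p) = v}"
    have im: "{p \<in> paths B b (Suc c). rng B (last p) = w} =
        (\<lambda>(e, q). q @ [e]) ` (SIGMA e:?I. ?P (src B e))" (is "?L = ?R")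
    proof
      show "?R \<subseteq> ?L" by (auto simp: paths_snoc[OF bc])
      show "?L \<subseteq> ?R"
      proof
        fix p assume p: "p \<in> ?L"
        then have "p \<noteq> []" using bc by (auto simp: paths_def)
        then obtain q e where "p = q @ [e]" by (metis rev_exhaust)
        then show "p \<in> ?R" using p by (auto simp: paths_snoc[OF bc])
      qed
    qed
    have hd: "hd (q @ [e]) = hd q" if "q \<in> paths B b c" for q and e
      using that bc by (cases q) (auto simp: paths_def)
    have "f (Suc c) w = (\<Sum>e\<in>?I. f c (src B e))"
      by (rule additive_fromD[OF f ac step.prems])
    also have "\<dots> = (\<Sum>e\<in>?I. \<Sum>q\<in>?P (src B e). f b (src B (hd q)))"
      using step.IH gradedD(1)[OF bratteli_graded[OF B]] by (auto intro!: sum.cong)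
    also have "\<dots> = (\<Sum>(e, q)\<in>(SIGMA e:?I. ?P (src B e)). f b (src B (hd q)))"
      using bratteli_finite_edges[OF B] finite_paths[OF B] by (subst sum.Sigma) auto
    also have "\<dots> = (\<Sum>p\<in>?R. f b (src B (hd p)))"
      by (subst sum.reindex) (auto simp: inj_on_def hd intro!: sum.cong)
    finally show ?case unfolding im .
  qed
qed

lemma additive_from_telescoping:
  assumes B: "bratteli B" and m: "strict_mono m" and f: "additive_from B (m a) f"
  shows "additive_from (telescoping B m) a (\<lambda>n. f (m n))"
  unfolding additive_from_def
proof (intro allI impI ballI)
  fix n v assume "a \<le> n" and v: "v \<in> verts (telescoping B m) (Suc n)"
  then have "m a \<le> m n" "m n < m (Suc n)"
    using m by (simp_all add: strict_mono_less_eq strict_mono_less)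
  then show "f (m (Suc n)) v =
      (\<Sum>e\<in>{e \<in> edges (telescoping B m) (Suc n). rng (telescoping B m) e = v}.
        f (m n) (src (telescoping B m) e))"
    using additive_from_paths[OF B f, of "m n" "m (Suc n)" v] v by (simp add: telescoping_def)
qed

text \<open>
  An additive function on a telescoping is known only on the levels kept. The others are
  filled in by rerunning the recursion in the diagram from the first level on which it lives;
  \<open>additive_from_unique\<close> shows that this agrees with the given values on the levels kept.
\<close>

primrec extend_up :: "('v, 'e) diagram \<Rightarrow> nat \<Rightarrow> ('v \<Rightarrow> int) \<Rightarrow> nat \<Rightarrow> 'v \<Rightarrow> int" where
  "extend_up B a h 0 v = h v"
| "extend_up B a h (Suc k) v =
     (\<Sum>e\<in>{e \<in> edges B (Suc (a + k)). rng B e = v}. extend_up B a h k (src B e))"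

lemma additive_from_extend_up: "additive_from B a (\<lambda>n. extend_up B a h (n - a))"
  by (auto simp: additive_from_def Suc_diff_le)

lemma label_proportional_telescoping:
  "label_proportional (telescoping B m) (\<lambda>n. f (m n)) n \<longleftrightarrow> label_proportional B f (m n)"
  by (simp add: label_proportional_def telescoping_def)

lemma rank_one_limit_telescoping:
  assumes B: "bratteli B" and m: "strict_mono m"
  shows "rank_one_limit (telescoping B m) \<longleftrightarrow> rank_one_limit B"
proof
  let ?C = "telescoping B m"
  have ge: "n \<le> m n" for n
    using m by (rule strict_mono_imp_increasing)
  {
    assume C: "rank_one_limit ?C"
    show "rank_one_limit B"
      unfolding rank_one_limit_def
    proof (intro allI impI)
      fix a f assume "additive_from B a f"
      then have "additive_from ?C a (\<lambda>n. f (m n))"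
        using additive_from_mono ge additive_from_telescoping[OF B m] by blast
      then obtain n where "a \<le> n" "label_proportional ?C (\<lambda>n. f (m n)) n"
        by (rule rank_one_limitE[OF C])
      then show "\<exists>n\<ge>a. label_proportional B f n"
        unfolding label_proportional_telescoping using ge le_trans by blast
    qed
  next
    assume R: "rank_one_limit B"
    show "rank_one_limit ?C"
      unfolding rank_one_limit_def
    proof (intro allI impI)
      fix a f assume f: "additive_from ?C a f"
      define g where "g n = extend_up B (m a) (f a) (n - m a)" for n
      have g: "additive_from B (m a) g"
        unfolding g_def by (rule additive_from_extend_up)
      have eq: "f n v = g (m n) v" if "a \<le> n" "v \<in> verts ?C n" for n v
        by (rule additive_from_unique[OF graded_telescoping[OF bratteli_graded[OF B] m] f
              additive_from_telescoping[OF B m g] _ that]) (simp add: g_def)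
      obtain b where b: "m a \<le> b" "label_proportional B g b"
        by (rule rank_one_limitE[OF R g])
      have "a \<le> b" using ge b(1) le_trans by blast
      \<comment> \<open>Level \<open>b\<close> may have been skipped by \<open>m\<close>; the level \<open>m b\<close> is kept and not below it.\<close>
      have "label_proportional B g (m b)"
        by (rule label_proportional_mono[OF B g b(1) ge b(2)])
      then have "label_proportional ?C (\<lambda>n. g (m n)) b"
        by (simp add: label_proportional_telescoping)
      then have "label_proportional ?C f b"
        using eq[OF \<open>a \<le> b\<close>] by (simp add: label_proportional_def)
      then show "\<exists>n\<ge>a. label_proportional ?C f n"
        using \<open>a \<le> b\<close> by blast
    qed
  }
qed

lemma divides_level_telescoping:
  assumes B: "bratteli B" and m: "strict_mono m"
  shows "divides_level d (telescoping B m) \<longleftrightarrow> divides_level d B"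
proof
  assume "divides_level d (telescoping B m)"
  then show "divides_level d B"
    by (auto simp: divides_level_def telescoping_def)
next
  assume "divides_level d B"
  then obtain n where "\<And>v. v \<in> verts B n \<Longrightarrow> d dvd lab B v"
    by (auto simp: divides_level_def)
  then have "\<forall>v\<in>verts B (m n). d dvd lab B v"
    using dvd_lab_mono[OF B] strict_mono_imp_increasing[OF m] by blast
  then show "divides_level d (telescoping B m)"
    by (auto simp: divides_level_def telescoping_def)
qed

section \<open>Two invariants of telescope equivalence\<close>

lemma telescope_step_invariants:
  assumes "telescope_step B C"
  shows "(rank_one_limit B \<longleftrightarrow> rank_one_limit C) \<and> (divides_level d B \<longleftrightarrow> divides_level d C)"
proof -
  have B: "bratteli B" using assms by (simp add: telescope_step_def)
  consider "isomorphic B C" | m where "strict_mono m" "isomorphic (telescoping B m) C"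
    using assms by (auto simp: telescope_step_def)
  then show ?thesis
  proof cases
    case 1
    show ?thesis
      using rank_one_limit_iso[OF bratteli_graded[OF B] 1] divides_level_iso[OF 1, of d] by simp
  next
    case (2 m)
    show ?thesis
      using rank_one_limit_iso[OF graded_telescoping[OF bratteli_graded[OF B] 2(1)] 2(2)]
        rank_one_limit_telescoping[OF B 2(1)]
        divides_level_iso[OF 2(2), of d] divides_level_telescoping[OF B 2(1), of d]
      by simp
  qed
qed

lemma telescope_equivalent_invariants:
  assumes "telescope_equivalent D D'"
  shows "rank_one_limit D \<longleftrightarrow> rank_one_limit D'" "divides_level d D \<longleftrightarrow> divides_level d D'"
proof -
  obtain B C where D: "bratteli D" and C: "bratteli C" and DB: "isomorphic D B"
    and BC: "equivclp telescope_step B C" and CD: "isomorphic C D'"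
    using assms unfolding telescope_equivalent_def by blast
  have "(rank_one_limit B \<longleftrightarrow> rank_one_limit C) \<and> (divides_level d B \<longleftrightarrow> divides_level d C)"
    using BC
  proof (induction rule: equivclp_induct)
    case base
    show ?case by simp
  next
    case (step X Y)
    have "(rank_one_limit X \<longleftrightarrow> rank_one_limit Y) \<and> (divides_level d X \<longleftrightarrow> divides_level d Y)"
      using step.hyps(2)
    proof
      assume "telescope_step X Y"
      then show ?thesis by (rule telescope_step_invariants)
    next
      assume "telescope_step Y X"
      from telescope_step_invariants[OF this, of d] show ?thesis by simp
    qed
    with step.IH show ?case by simp
  qed
  then show "rank_one_limit D \<longleftrightarrow> rank_one_limit D'" "divides_level d D \<longleftrightarrow> divides_level d D'"
    using rank_one_limit_iso[OF bratteli_graded[OF D] DB] divides_level_iso[OF DB, of d]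
      rank_one_limit_iso[OF bratteli_graded[OF C] CD] divides_level_iso[OF CD, of d]
    by (simp_all only:)
qed


section \<open>Diagrams of matrices\<close>

lemma matrix_diagram_verts: "verts (matrix_diagram M) n = {n} \<times> {..<dim_row M}"
  and matrix_diagram_lab: "lab (matrix_diagram M) (n, j) = matrix_label M n j"
  by (simp_all add: matrix_diagram_def)

lemma additive_from_matrix_diagram:
  "additive_from (matrix_diagram M) a f \<longleftrightarrow>
    (\<forall>n\<ge>a. \<forall>j<dim_row M.
      f (Suc n) (Suc n, j) = (\<Sum>i<dim_row M. f n (n, i) * int (M $$ (i, j))))"
proof -
  let ?B = "matrix_diagram M" and ?k = "dim_row M"
  have "(\<Sum>e\<in>{e \<in> edges ?B (Suc n). rng ?B e = (Suc n, j)}. f n (src ?B e)) =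
      (\<Sum>i<?k. f n (n, i) * int (M $$ (i, j)))" if j: "j < ?k" for n j
  proof -
    have into: "{e \<in> edges ?B (Suc n). rng ?B e = (Suc n, j)} =
        (\<lambda>(i, c). (Suc n, i, j, c)) ` (SIGMA i:{..<?k}. {..<M $$ (i, j)})"
      using j by (auto simp: matrix_diagram_def)
    have inj: "inj_on (\<lambda>(i, c). (Suc n, i, j, c)) (SIGMA i:{..<?k}. {..<M $$ (i, j)})"
      by (auto simp: inj_on_def)
    have "(\<Sum>e\<in>{e \<in> edges ?B (Suc n). rng ?B e = (Suc n, j)}. f n (src ?B e)) =
        (\<Sum>(i, c)\<in>(SIGMA i:{..<?k}. {..<M $$ (i, j)}). f n (n, i))"
      unfolding into sum.reindex[OF inj]
      by (rule sum.cong) (auto simp: matrix_diagram_def)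
    also have "\<dots> = (\<Sum>i<?k. \<Sum>c<M $$ (i, j). f n (n, i))"
      by (subst sum.Sigma) auto
    also have "\<dots> = (\<Sum>i<?k. f n (n, i) * int (M $$ (i, j)))"
      by (simp add: mult.commute)
    finally show ?thesis .
  qed
  then show ?thesis
    by (auto simp: additive_from_def matrix_diagram_verts)
qed

text \<open>
  An invertible matrix makes every step of the direct system injective, so an additive function
  that vanishes on some level vanished from the start.
\<close>

lemma additive_from_zero_descends:
  assumes sq: "dim_row M = dim_col M" and det: "invertible_over_rat M"
    and g: "additive_from (matrix_diagram M) 0 g"
    and zero: "\<And>j. j < dim_row M \<Longrightarrow> g n (n, j) = 0"
    and "i < dim_row M"
  shows "g 0 (0, i) = 0"
  using zero \<open>i < dim_row M\<close>
proof (induction n arbitrary: i)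
  case 0
  then show ?case by simp
next
  case (Suc n)
  let ?k = "dim_row M"
  let ?A = "(map_mat rat_of_nat M)\<^sup>T"
  let ?z = "vec ?k (\<lambda>i. rat_of_int (g n (n, i)))"
  have A: "?A \<in> carrier_mat ?k ?k" using sq by auto
  have "map_mat rat_of_nat M \<in> carrier_mat ?k ?k" using sq by auto
  then have "det ?A = det (map_mat rat_of_nat M)" by (rule det_transpose)
  then have det_A: "det ?A \<noteq> 0"
    using det by (simp only: invertible_over_rat_def not_False_eq_True)
  have Az: "?A *\<^sub>v ?z = 0\<^sub>v ?k"
  proof (rule eq_vecI)
    fix j assume "j < dim_vec (0\<^sub>v ?k :: rat vec)"
    then have j: "j < ?k" by simp
    have "(?A *\<^sub>v ?z) $ j = (\<Sum>i<?k. rat_of_nat (M $$ (i, j)) * rat_of_int (g n (n, i)))"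
      using j sq by (simp add: scalar_prod_def atLeast0LessThan)
    also have "\<dots> = rat_of_int (\<Sum>i<?k. g n (n, i) * int (M $$ (i, j)))"
      by (simp add: mult.commute)
    also have "\<dots> = rat_of_int (g (Suc n) (Suc n, j))"
      using g[unfolded additive_from_matrix_diagram, rule_format, of n j] j by simp
    finally show "(?A *\<^sub>v ?z) $ j = 0\<^sub>v ?k $ j"
      using Suc.prems(1)[OF j] j by simp
  qed (use sq in simp)
  have z0: "?z = 0\<^sub>v ?k"
  proof (rule ccontr)
    assume "?z \<noteq> 0\<^sub>v ?k"
    then have "det ?A = 0"
      unfolding det_0_iff_vec_prod_zero_field[OF A] using Az vec_carrier[of ?k] by blast
    with det_A show False by contradiction
  qed
  have "g n (n, i) = 0" if i: "i < ?k" for i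
  proof -
    have "?z $ i = 0\<^sub>v ?k $ i" by (simp only: z0)
    then show ?thesis using i by simp
  qed
  then show ?case by (rule Suc.IH) (use Suc.prems(2) in simp_all)
qed

lemma additive_from_matrix_label:
  "additive_from (matrix_diagram M) 0 (\<lambda>n v. int (matrix_label M n (snd v)))"
  by (simp add: additive_from_matrix_diagram)

text \<open>
  Were the image of the first unit vector proportional to the labels at some level, a linear
  combination of the two would vanish there, hence also at level 0. But for size at least 2
  the first unit vector and the all-ones vector are linearly independent.
\<close>

lemma invertible_not_rank_one_limit:
  assumes sq: "dim_row M = dim_col M" and det: "invertible_over_rat M" and k: "dim_row M \<ge> 2"
  shows "\<not> rank_one_limit (matrix_diagram M)"
proof
  let ?B = "matrix_diagram M"
  assume R: "rank_one_limit ?B"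
  define f where "f n = extend_up ?B 0 (\<lambda>v. if v = (0, 0) then 1 else 0) n" for n
  define l where "l n v = int (matrix_label M n (snd v))" for n and v :: "nat \<times> nat"
  have f: "additive_from ?B 0 f"
    using additive_from_extend_up[of ?B 0] unfolding f_def by simp
  have l: "additive_from ?B 0 l"
    unfolding l_def by (rule additive_from_matrix_label)
  obtain n where n: "label_proportional ?B f n"
    by (rule rank_one_limitE[OF R f])
  have "f n (n, j) = 0" if j: "j < dim_row M" for j
  proof -
    \<comment> \<open>Both coefficients are values at level \<open>n\<close>, so that \<open>g\<close> vanishes at that level.\<close>
    define g where "g r v = l n (n, j) * f r v - f n (n, j) * l r v" for r v
    have "additive_from ?B 0 g"
      using f l unfolding additive_from_matrix_diagram g_def
      by (simp add: left_diff_distrib sum_subtractf sum_distrib_left mult.assoc)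
    moreover have "g n (n, i) = 0" if "i < dim_row M" for i
      using n that j
      by (simp add: g_def l_def label_proportional_def matrix_diagram_verts matrix_diagram_lab
          mult.commute)
    \<comment> \<open>At vertex 1 the unit vector is 0 and the label is 1, which isolates \<open>f n (n, j)\<close>.\<close>
    ultimately have "g 0 (0, 1) = 0"
      using additive_from_zero_descends[OF sq det, of g n 1] k by simp
    then show ?thesis by (simp add: g_def f_def l_def)
  qed
  then have "f 0 (0, 0) = 0"
    using additive_from_zero_descends[OF sq det f, of n 0] k by simp
  then show False by (simp add: f_def)
qed

lemma matrix_label_one_by_one:
  assumes "dim_row M = 1"
  shows "matrix_label M n 0 = (M $$ (0, 0)) ^ n"
  using assms by (induction n) (simp_all add: mult.commute)

lemma divides_level_one_by_one:
  assumes "dim_row M = 1" "divides_level 2 (matrix_diagram M)"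
  shows "divides_level 4 (matrix_diagram M)"
proof -
  obtain n where "2 dvd (M $$ (0, 0)) ^ n"
    using assms
    by (auto simp: divides_level_def matrix_diagram_verts matrix_diagram_lab matrix_label_one_by_one)
  then have "2 dvd M $$ (0, 0)"
    using prime_dvd_power two_is_prime_nat by blast
  then have "2 * 2 dvd M $$ (0, 0) * M $$ (0, 0)"
    by (rule mult_dvd_mono) fact
  then have "4 dvd (M $$ (0, 0)) ^ 2"
    by (simp add: power2_eq_square)
  then show ?thesis
    unfolding divides_level_def using assms(1)
    by (intro exI[of _ 2])
      (simp add: matrix_diagram_verts matrix_diagram_lab matrix_label_one_by_one)
qed

section \<open>The singular matrix\<close>

definition witness_matrix :: "nat mat" where
  "witness_matrix = mat 2 2 (\<lambda>(i, j). if j = 0 then 1 else 2)"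

lemma witness_matrix_dim [simp]: "dim_row witness_matrix = 2" "dim_col witness_matrix = 2"
  by (simp_all add: witness_matrix_def)

lemma witness_matrix_entry [simp]:
  "i < 2 \<Longrightarrow> j < 2 \<Longrightarrow> witness_matrix $$ (i, j) = (if j = 0 then 1 else 2)"
  by (simp add: witness_matrix_def)

lemma lessThan_2: "{..<2::nat} = {0, 1}"
  by auto

lemma substitution_witness_matrix: "substitution_matrix witness_matrix"
proof -
  have "substitution [0, 1] (\<lambda>_. [0, 1, 1::nat])"
    by (simp add: substitution_def)
  moreover have "witness_matrix = matrix_of_substitution [0, 1] (\<lambda>_. [0, 1, 1::nat])"
    by (rule eq_matI) (auto simp: witness_matrix_def matrix_of_substitution_def less_2_cases_iff
      numeral_2_eq_2 less_Suc_eq)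
  ultimately show ?thesis unfolding substitution_matrix_def by blast
qed

lemma no_zero_witness_matrix: "no_zero_row_or_column witness_matrix"
  unfolding no_zero_row_or_column_def by (auto intro!: exI[of _ 0])

lemma singular_witness_matrix: "\<not> invertible_over_rat witness_matrix"
proof -
  have "det (map_mat rat_of_nat witness_matrix) = 0"
  proof (rule det_identical_rows)
    show "map_mat rat_of_nat witness_matrix \<in> carrier_mat 2 2"
      by (intro carrier_matI) simp_all
    show "row (map_mat rat_of_nat witness_matrix) 0 = row (map_mat rat_of_nat witness_matrix) 1"
      by (rule eq_vecI) simp_all
  qed simp_all
  then show ?thesis by (simp add: invertible_over_rat_def)
qed

lemma matrix_label_witness_matrix:
  "j < 2 \<Longrightarrow> matrix_label witness_matrix (Suc n) j = 2 * 3 ^ n * (if j = 0 then 1 else 2)"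
proof (induction n arbitrary: j)
  case 0
  then show ?case by (simp add: lessThan_2)
next
  case (Suc n)
  have "matrix_label witness_matrix (Suc (Suc n)) j =
      (\<Sum>i<2. matrix_label witness_matrix (Suc n) i * witness_matrix $$ (i, j))"
    by (simp only: matrix_label.simps(2)[of _ "Suc n"] witness_matrix_dim)
  also have "\<dots> = (2 * 3 ^ n + 2 * 3 ^ n * 2) * (if j = 0 then 1 else 2)"
    using Suc by (simp add: lessThan_2 del: matrix_label.simps)
  finally show ?case by simp
qed

text \<open>Both rows of the matrix are \<open>(1, 2)\<close>, so a single step already maps every row vector to a
  multiple of \<open>(1, 2)\<close>.\<close>

lemma rank_one_limit_witness_matrix: "rank_one_limit (matrix_diagram witness_matrix)"
  unfolding rank_one_limit_def
proof (intro allI impI)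
  fix a and f :: "nat \<Rightarrow> nat \<times> nat \<Rightarrow> int"
  assume "additive_from (matrix_diagram witness_matrix) a f"
  then have step: "f (Suc a) (Suc a, j) =
      (\<Sum>i<2. f a (a, i) * int (witness_matrix $$ (i, j)))" if "j < 2" for j
    using that unfolding additive_from_matrix_diagram witness_matrix_dim by blast
  have "f (Suc a) (Suc a, j) = (f a (a, 0) + f a (a, 1)) * (if j = 0 then 1 else 2)"
    if "j < 2" for j
    unfolding step[OF that] using that by (simp add: lessThan_2)
  then have "label_proportional (matrix_diagram witness_matrix) f (Suc a)"
    unfolding label_proportional_def matrix_diagram_verts
    by (auto simp: matrix_diagram_lab matrix_label_witness_matrix simp del: matrix_label.simps)
  then show "\<exists>n\<ge>a. label_proportional (matrix_diagram witness_matrix) f n"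
    using le_SucI by blast
qed

lemma divides_level_2_witness_matrix: "divides_level 2 (matrix_diagram witness_matrix)"
  unfolding divides_level_def
proof (intro exI ballI)
  fix v assume "v \<in> verts (matrix_diagram witness_matrix) (Suc 0)"
  then obtain j where "v = (Suc 0, j)" "j < 2"
    by (auto simp: matrix_diagram_verts)
  then show "2 dvd lab (matrix_diagram witness_matrix) v"
    using matrix_label_witness_matrix[of j 0] by (simp only: matrix_diagram_lab) simp
qed

lemma not_divides_level_4_witness_matrix: "\<not> divides_level 4 (matrix_diagram witness_matrix)"
proof
  assume "divides_level 4 (matrix_diagram witness_matrix)"
  then obtain n where "\<forall>v\<in>verts (matrix_diagram witness_matrix) n.
      4 dvd lab (matrix_diagram witness_matrix) v"
    unfolding divides_level_def by blast
  moreover have "(n, 0) \<in> verts (matrix_diagram witness_matrix) n"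
    by (simp add: matrix_diagram_verts)
  ultimately have n: "4 dvd matrix_label witness_matrix n 0"
    unfolding matrix_diagram_lab[symmetric] by blast
  show False
  proof (cases n)
    case 0
    then show ?thesis using n by simp
  next
    case (Suc k)
    have "matrix_label witness_matrix (Suc k) 0 = 2 * 3 ^ k"
      using matrix_label_witness_matrix[of 0 k] by (simp del: matrix_label.simps)
    moreover have "odd ((3::nat) ^ k)" by simp
    ultimately show ?thesis
      using n unfolding Suc by presburger
  qed
qed

theorem mainTheorem3:
  shows "\<exists>M. substitution_matrix M \<and> no_zero_row_or_column M \<and> \<not> invertible_over_rat M \<and>
    (\<forall>M'. substitution_matrix M' \<and> invertible_over_rat M' \<longrightarrow>
      \<not> telescope_equivalent (matrix_diagram M) (matrix_diagram M'))"
proof (intro exI[of _ witness_matrix] conjI allI impI notI)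
  show "substitution_matrix witness_matrix" by (rule substitution_witness_matrix)
  show "no_zero_row_or_column witness_matrix" by (rule no_zero_witness_matrix)
  show "invertible_over_rat witness_matrix \<Longrightarrow> False" using singular_witness_matrix by blast
next
  fix M' assume M': "substitution_matrix M' \<and> invertible_over_rat M'"
    and "telescope_equivalent (matrix_diagram witness_matrix) (matrix_diagram M')"
  note inv = telescope_equivalent_invariants[OF this(2)]
  have sq: "dim_row M' = dim_col M'" and pos: "dim_row M' > 0"
    using M' by (auto simp: substitution_matrix_def substitution_def matrix_of_substitution_def)
  have "rank_one_limit (matrix_diagram M')"
    using inv(1) rank_one_limit_witness_matrix by blast
  then have "\<not> dim_row M' \<ge> 2"
    using invertible_not_rank_one_limit[OF sq] M' by blast
  then have one: "dim_row M' = 1" using pos by simp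
  show False
    using divides_level_one_by_one[OF one] inv(2) divides_level_2_witness_matrix
      not_divides_level_4_witness_matrix by blast
qed

end
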